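(* Let $V=V_{\mathbb{R}}\otimes\mathbb{C}$ with $V_{\mathbb{R}}=\mathbb{R}^{2d}$. The locally convex topology on $\mathrm{S}^\bullet(V)$ induced by the seminorms $\{\|\cdot\|_\epsilon\}_{\epsilon>0}$ coincides with the topology of the Weyl algebra $\mathcal{W}_{R^-}(V)$ for $R=1$.
   Context: $V$ is purely even, with basis $z^1,\ldots,z^d,\overline{z}^1,\ldots,\overline{z}^d$ (the complex coordinates), so that $\mathrm{S}^\bullet(V)=\mathbb{C}[z^1,\ldots,z^d,\overline{z}^1,\ldots,\overline{z}^d]$; here $\mathrm{S}^n(V)\subseteq V^{\otimes n}$ is the space of symmetric tensors and the product is the symmetrized tensor product. Write $a\in \mathrm{S}^\bullet(V)$ as $a=\sum_{I,J}a_{IJ}\frac{z^I\overline{z}^J}{I!J!}$ with multiindices $I,J\in\mathbb{N}_0^d$. For $\epsilon>0$ set $$\|a\|_\epsilon=\sup_{I,J}\frac{|a_{IJ}|}{|I+J|!^\epsilon}.$$ $\mathcal{W}_{R^-}(V)$ is, as a locally convex space, $\mathrm{S}^\bullet(V)$ with the topology defined by all seminorms $p_{R-\epsilon}$ with $\epsilon>0$ and $p$ a seminorm on $V$, where $p_{R'}(a)=\sum_{n\ge0}p^n(a_n)\,n!^{R'}$ for $a=\sum_na_n$, $a_n\in \mathrm{S}^n(V)$, and $p^n$ is the projective tensor seminorm $p\otimes\cdots\otimes p$ on $V^{\otimes n}$ ($p^0=|\cdot|$). *)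

theory Defs
  imports "HOL-Analysis.Analysis" "HOL-Combinatorics.Permutations"
begin

section \<open>Tensors over a finite-dimensional complex vector space\<close>

text \<open>
  An element of the tensor algebra of \<open>complex ^ 'm\<close> is given by its coordinates with respect
  to the tensor products of standard basis vectors: the value at the word \<open>[m\<^sub>1, ..., m\<^sub>n]\<close> is the
  coefficient of \<open>axis m\<^sub>1 1 \<otimes> ... \<otimes> axis m\<^sub>n 1\<close>. Its component of degree \<open>n\<close> is its restriction
  to words of length \<open>n\<close>.
\<close>

type_synonym 'm tensor = "'m list \<Rightarrow> complex"

definition elem_tensor :: "(complex ^ 'm) list \<Rightarrow> 'm::finite tensor" where
  "elem_tensor vs = (\<lambda>w. if length w = length vs then \<Prod>k<length vs. (vs ! k) $ (w ! k) else 0)"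

definition tensor_prod :: "'m tensor \<Rightarrow> 'm tensor \<Rightarrow> 'm tensor" where
  "tensor_prod a b = (\<lambda>w. \<Sum>k\<le>length w. a (take k w) * b (drop k w))"

definition homogeneous_part :: "nat \<Rightarrow> 'm tensor \<Rightarrow> 'm tensor" where
  "homogeneous_part n a = (\<lambda>w. if length w = n then a w else 0)"


section \<open>The symmetric algebra\<close>

text \<open>
  Finite support expresses that only finitely many degrees occur, the index type being finite.
\<close>

definition sym_algebra :: "'m::finite tensor set" where
  "sym_algebra = {a. finite {w. a w \<noteq> 0} \<and>
     (\<forall>w \<sigma>. \<sigma> permutes {..<length w} \<longrightarrow> a (permute_list \<sigma> w) = a w)}"

definition symmetrize :: "'m tensor \<Rightarrow> 'm tensor" where
  "symmetrize a =
     (\<lambda>w. (\<Sum>\<sigma> | \<sigma> permutes {..<length w}. a (permute_list \<sigma> w)) / fact (length w))"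

definition sym_prod :: "'m tensor \<Rightarrow> 'm tensor \<Rightarrow> 'm tensor" where
  "sym_prod a b = symmetrize (tensor_prod a b)"

text \<open>
  The unit of the symmetric algebra is \<open>elem_tensor []\<close>, and a vector \<open>v\<close>, regarded as an element
  of degree 1, is \<open>elem_tensor [v]\<close>.
\<close>

definition sym_prod_list :: "(complex ^ 'm) list \<Rightarrow> 'm::finite tensor" where
  "sym_prod_list vs = foldr (\<lambda>v a. sym_prod (elem_tensor [v]) a) vs (elem_tensor [])"


section \<open>Projective tensor seminorms and the Weyl algebra topology\<close>

definition complex_seminorm :: "(complex ^ 'm \<Rightarrow> real) \<Rightarrow> bool" where
  "complex_seminorm p \<longleftrightarrow>
     (\<forall>x y. p (x + y) \<le> p x + p y) \<and> (\<forall>c x. p (c *s x) = cmod c * p x)"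

definition proj_seminorm ::
    "(complex ^ 'm \<Rightarrow> real) \<Rightarrow> nat \<Rightarrow> 'm::finite tensor \<Rightarrow> real" where
  "proj_seminorm p n T = (if n = 0 then cmod (T []) else
     Inf {(\<Sum>vs\<leftarrow>vss. \<Prod>v\<leftarrow>vs. p v) | vss.
            (\<forall>vs\<in>set vss. length vs = n) \<and> T = (\<lambda>w. \<Sum>vs\<leftarrow>vss. elem_tensor vs w)})"

definition weyl_seminorm ::
    "(complex ^ 'm \<Rightarrow> real) \<Rightarrow> real \<Rightarrow> 'm::finite tensor \<Rightarrow> real" where
  "weyl_seminorm p R a = (\<Sum>n. proj_seminorm p n (homogeneous_part n a) * fact n powr R)"

text \<open>
  The topology on \<open>S\<close> with the open balls of the seminorms in \<open>Q\<close> as a subbase; finite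
  intersections of balls are formed by \<open>topology_generated_by\<close>.
\<close>

definition seminorm_topology ::
    "'m tensor set \<Rightarrow> ('m tensor \<Rightarrow> real) set \<Rightarrow> 'm tensor topology" where
  "seminorm_topology S Q = topology_generated_by
     {{b \<in> S. q (\<lambda>w. b w - a w) < r} | q a r. q \<in> Q \<and> a \<in> S \<and> 0 < r}"

definition weyl_topology :: "real \<Rightarrow> 'm::finite tensor topology" where
  "weyl_topology R = seminorm_topology sym_algebra
     {weyl_seminorm p (R - \<epsilon>) | p \<epsilon>. complex_seminorm p \<and> 0 < \<epsilon>}"


section \<open>Complex coordinates\<close>

text \<open>
  For a finite linearly ordered index type \<open>'d\<close> with \<open>d\<close> elements, \<open>real ^ ('d + 'd)\<close> is the
  space \<open>V\<^sub>\<real> = \<real>\<^bsup>2d\<^esup>\<close> with real coordinates \<open>x\<^sup>k\<close> (index \<open>Inl k\<close>) and \<open>y\<^sup>k\<close> (index \<open>Inr k\<close>), and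
  \<open>complex ^ ('d + 'd)\<close> is its complexification \<open>V\<close>.
\<close>

definition z_coord :: "'d::finite \<Rightarrow> complex ^ ('d + 'd)" where
  "z_coord k = axis (Inl k) 1 + \<i> *s axis (Inr k) 1"

definition zbar_coord :: "'d::finite \<Rightarrow> complex ^ ('d + 'd)" where
  "zbar_coord k = axis (Inl k) 1 - \<i> *s axis (Inr k) 1"

type_synonym 'd multiindex = "'d \<Rightarrow> nat"

definition mi_size :: "'d::finite multiindex \<Rightarrow> nat" where
  "mi_size I = (\<Sum>k\<in>UNIV. I k)"

definition mi_fact :: "'d::finite multiindex \<Rightarrow> nat" where
  "mi_fact I = (\<Prod>k\<in>UNIV. fact (I k))"

definition mi_factors ::
    "('d \<Rightarrow> complex ^ ('d + 'd)) \<Rightarrow> 'd::{finite,linorder} multiindex \<Rightarrow> (complex ^ ('d + 'd)) list"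
  where
  "mi_factors v I = concat (map (\<lambda>k. replicate (I k) (v k)) (sorted_list_of_set UNIV))"

text \<open>The monomial \<open>z\<^sup>I zbar\<^sup>J\<close>, a product in the symmetric algebra.\<close>

definition monomial ::
    "'d::{finite,linorder} multiindex \<Rightarrow> 'd multiindex \<Rightarrow> ('d + 'd) tensor" where
  "monomial I J = sym_prod_list (mi_factors z_coord I @ mi_factors zbar_coord J)"

text \<open>
  The Taylor coefficients \<open>a\<^sub>I\<^sub>J\<close>: the unique finitely supported family that represents \<open>a\<close> as the
  sum of all \<open>a\<^sub>I\<^sub>J z\<^sup>I zbar\<^sup>J / (I! J!)\<close>.
\<close>

definition taylor_coeff ::
    "('d + 'd) tensor \<Rightarrow> 'd::{finite,linorder} multiindex \<times> 'd multiindex \<Rightarrow> complex" where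
  "taylor_coeff a = (THE c. finite {IJ. c IJ \<noteq> 0} \<and>
     a = (\<lambda>w. \<Sum>(I, J) | c (I, J) \<noteq> 0.
            c (I, J) * monomial I J w / of_nat (mi_fact I * mi_fact J)))"

definition coeff_norm :: "real \<Rightarrow> ('d::{finite,linorder} + 'd) tensor \<Rightarrow> real" where
  "coeff_norm \<epsilon> a =
     (SUP (I, J). cmod (taylor_coeff a (I, J)) / fact (mi_size (\<lambda>k. I k + J k)) powr \<epsilon>)"

end

theory Submission
  imports Defs "HOL-Combinatorics.Multiset_Permutations"
begin

text \<open>
  Both families of seminorms measure the same numbers, the coordinates of the tensor \<open>a\<close> in the
  basis of complex coordinates. Write \<open>a\<^sub>u\<close> for the coordinate at a word \<open>u\<close> of length \<open>n\<close> in the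
  letters \<open>z\<^sup>k, zbar\<^sup>k\<close>. As \<open>a\<close> is symmetric, \<open>a\<^sub>u\<close> depends only on the multiplicities \<open>(I, J)\<close> of the
  letters. The monomial \<open>z\<^sup>I zbar\<^sup>J\<close> is the average of the \<open>n! / (I! J!)\<close> words of type \<open>(I, J)\<close>, so that
  the Taylor coefficient is \<open>a\<^sub>I\<^sub>J = n! a\<^sub>u\<close> (lemma \<open>taylor_coeff\<close>). The norm \<open>coeff_norm \<epsilon>\<close> is therefore
  the supremum of \<open>n!\<^bsup>1-\<epsilon>\<^esup> |a\<^sub>u|\<close> over all words, while the Weyl seminorms are weighted sums over \<open>n\<close>
  of \<open>n!\<^bsup>1-\<epsilon>\<^esup> p\<^sup>n(a\<^sub>n)\<close>.

  In degree \<open>n\<close>, the projective seminorm \<open>p\<^sup>n\<close> of a suitable \<open>p\<close> and the supremum of the coordinates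
  differ at most by a factor that is exponential in \<open>n\<close>. On the one hand, for the seminorm \<open>p\<close> that sums the moduli
  of the coordinates of a vector, every \<open>|a\<^sub>u|\<close> is at most \<open>p\<^sup>n(a\<^sub>n)\<close> (\<open>proj_seminorm_lower\<close>). On the
  other hand, expanding in the basis gives \<open>p\<^sup>n(a\<^sub>n) \<le> M\<^sup>n \<Sum>\<^sub>u |a\<^sub>u|\<close> for every \<open>p\<close>, a sum with \<open>(2d)\<^sup>n\<close>
  terms (\<open>proj_seminorm_upper\<close>). The first bound yields \<open>coeff_norm \<epsilon> a \<le> weyl_seminorm p (1 - \<epsilon>) a\<close>.
  In the second, replacing \<open>\<epsilon>\<close> by \<open>\<epsilon> / 2\<close> gains a factor \<open>n!\<^bsup>-\<epsilon>/2\<^esup>\<close>, which beats every exponential and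
  makes the series converge: \<open>weyl_seminorm p (1 - \<epsilon>) a \<le> C \<cdot> coeff_norm (\<epsilon> / 2) a\<close>. Since \<open>\<epsilon> > 0\<close> is
  arbitrary in both families, this loss is harmless, and mutual domination of the families gives
  equality of the topologies.
\<close>

section \<open>Comparing topologies given by seminorms\<close>

text \<open>
  Domination up to a constant is enough: by subadditivity, a ball of \<open>q\<close> contains a ball of \<open>q'\<close>
  around each of its points, so it is open in the topology of \<open>Q'\<close>.
\<close>

lemma seminorm_topology_coarser:
  assumes diff: "\<And>a b. a \<in> S \<Longrightarrow> b \<in> S \<Longrightarrow> (\<lambda>w. a w - b w) \<in> S"
    and triangle: "\<And>q a b. q \<in> Q \<Longrightarrow> a \<in> S \<Longrightarrow> b \<in> S \<Longrightarrow> q (\<lambda>w. a w + b w) \<le> q a + q b"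
    and zero: "\<And>q. q \<in> Q' \<Longrightarrow> q (\<lambda>w. 0) = 0"
    and dominated: "\<And>q. q \<in> Q \<Longrightarrow> \<exists>q'\<in>Q'. \<exists>C>0. \<forall>a\<in>S. q a \<le> C * q' a"
    and U: "openin (seminorm_topology S Q) U"
  shows "openin (seminorm_topology S Q') U"
proof -
  let ?T = "seminorm_topology S Q'"
  have "openin ?T {b \<in> S. q (\<lambda>w. b w - a w) < r}" (is "openin _ ?B")
    if q: "q \<in> Q" and a: "a \<in> S" for q a r
  proof (subst openin_subopen, rule ballI)
    fix b assume "b \<in> ?B"
    then have b: "b \<in> S" "q (\<lambda>w. b w - a w) < r" by auto
    obtain q' C where q': "q' \<in> Q'" "C > 0" "\<And>x. x \<in> S \<Longrightarrow> q x \<le> C * q' x"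
      using dominated[OF q] by blast
    \<comment> \<open>the room that the \<open>q\<close>-ball leaves around \<open>b\<close>, converted to the scale of \<open>q'\<close>\<close>
    define s where "s = (r - q (\<lambda>w. b w - a w)) / C"
    have s: "s > 0" using b q' by (simp add: s_def)
    let ?N = "{x \<in> S. q' (\<lambda>w. x w - b w) < s}"
    have "openin ?T ?N"
      unfolding seminorm_topology_def
      by (rule topology_generated_by_Basis) (use q' b s in blast)
    moreover have "b \<in> ?N" using zero[OF q'(1)] b s by simp
    moreover have "?N \<subseteq> ?B"
    proof clarify
      fix x assume x: "x \<in> S" "q' (\<lambda>w. x w - b w) < s"
      have "q (\<lambda>w. x w - a w) = q (\<lambda>w. (x w - b w) + (b w - a w))" by simp
      also have "\<dots> \<le> q (\<lambda>w. x w - b w) + q (\<lambda>w. b w - a w)"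
        by (intro triangle q diff x b a)
      also have "q (\<lambda>w. x w - b w) \<le> C * q' (\<lambda>w. x w - b w)"
        by (intro q' diff x b)
      also have "C * q' (\<lambda>w. x w - b w) < C * s" using x q' by simp
      also have "C * s = r - q (\<lambda>w. b w - a w)" using q' by (simp add: s_def)
      finally show "q (\<lambda>w. x w - a w) < r" by simp
    qed
    ultimately show "\<exists>N. openin ?T N \<and> b \<in> N \<and> N \<subseteq> ?B" by blast
  qed
  note basic = this
  show ?thesis
  proof (rule generate_topology_on_coarsest[OF istopology_openin])
    show "generate_topology_on {{b \<in> S. q (\<lambda>w. b w - a w) < r} | q a r. q \<in> Q \<and> a \<in> S \<and> 0 < r} U"
      using U unfolding seminorm_topology_def by (rule openin_topology_generated_by)
  qed (use basic in blast)
qed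

section \<open>Change of basis\<close>

lemma finite_words [simp]: "finite {u :: 'm::finite list. length u = n}"
  using finite_lists_length_eq[of "UNIV :: 'm set" n] by simp

lemma card_words: "card {u :: 'm::finite list. length u = n} = CARD('m) ^ n"
  using card_lists_length_eq[of "UNIV :: 'm set" n] by simp

lemma words_Suc: "{u. length u = Suc n} = (\<lambda>(m, u). m # u) ` (UNIV \<times> {u. length u = n})"
  by (auto simp: length_Suc_conv image_iff)

text \<open>
  The distributive law, with the choice of one summand from each of the \<open>n\<close> factors encoded as a word.
  All computations with tensor powers of matrices reduce to it.
\<close>

lemma sum_words_prod:
  fixes f :: "nat \<Rightarrow> 'm::finite \<Rightarrow> 'a::comm_semiring_1"
  shows "(\<Sum>u | length u = n. \<Prod>k<n. f k (u ! k)) = (\<Prod>k<n. \<Sum>m\<in>UNIV. f k m)"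
proof (induction n arbitrary: f)
  case (Suc n)
  have inj: "inj_on (\<lambda>(m, u). m # u) (UNIV \<times> {u. length u = n})"
    by (auto simp: inj_on_def)
  have "(\<Sum>u | length u = Suc n. \<Prod>k<Suc n. f k (u ! k))
      = (\<Sum>m\<in>UNIV. \<Sum>u | length u = n. f 0 m * (\<Prod>k<n. f (Suc k) (u ! k)))"
    unfolding words_Suc sum.reindex[OF inj] sum.cartesian_product
    by (simp add: prod.lessThan_Suc_shift case_prod_unfold del: prod.lessThan_Suc)
  also have "\<dots> = (\<Sum>m\<in>UNIV. f 0 m) * (\<Prod>k<n. \<Sum>m\<in>UNIV. f (Suc k) m)"
    by (simp add: sum_distrib_left[symmetric] sum_distrib_right[symmetric] Suc.IH[of "\<lambda>k. f (Suc k)"])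
  finally show ?case by (simp add: prod.lessThan_Suc_shift del: prod.lessThan_Suc)
qed simp

text \<open>
  The action of a matrix on the tensor algebra, by \<open>A \<otimes> \<dots> \<otimes> A\<close> in each degree.
\<close>

definition tensor_map :: "complex ^ 'm ^ 'm \<Rightarrow> 'm::finite tensor \<Rightarrow> 'm tensor" where
  "tensor_map A a =
     (\<lambda>w. \<Sum>u | length u = length w. (\<Prod>k<length w. A $ (w ! k) $ (u ! k)) * a u)"

lemma tensor_map_id: "tensor_map (mat 1) a = a"
proof
  fix w :: "'a list"
  have "(\<Prod>k<length w. mat 1 $ (w ! k) $ (u ! k)) = (if u = w then 1 else (0::complex))"
    if len: "length u = length w" for u :: "'a list"
  proof (cases "u = w")
    case False
    then obtain k where "k < length w" "u ! k \<noteq> w ! k" using len by (auto simp: list_eq_iff_nth_eq)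
    then show ?thesis using False by (auto simp: mat_def intro!: prod_zero bexI[of _ k])
  qed (simp add: mat_def)
  then have "tensor_map (mat 1) a w = (\<Sum>u | length u = length w. if u = w then a u else 0)"
    unfolding tensor_map_def by (intro sum.cong) auto
  then show "tensor_map (mat 1) a w = a w" by (simp add: sum.delta)
qed

lemma tensor_map_comp: "tensor_map A (tensor_map B a) = tensor_map (A ** B) a"
proof
  fix w :: "'a list"
  let ?W = "{u :: 'a list. length u = length w}"
  have "tensor_map A (tensor_map B a) w =
     (\<Sum>u\<in>?W. \<Sum>x\<in>?W. (\<Prod>k<length w. A $ (w ! k) $ (u ! k) * B $ (u ! k) $ (x ! k)) * a x)"
    unfolding tensor_map_def
    by (rule sum.cong) (auto simp: sum_distrib_left prod.distrib mult_ac)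
  also have "\<dots> =
     (\<Sum>x\<in>?W. (\<Sum>u\<in>?W. \<Prod>k<length w. A $ (w ! k) $ (u ! k) * B $ (u ! k) $ (x ! k)) * a x)"
    by (subst sum.swap) (simp add: sum_distrib_right)
  also have "\<dots> = tensor_map (A ** B) a w"
    unfolding tensor_map_def matrix_matrix_mult_def
    by (simp add: sum_words_prod[where f = "\<lambda>k m. A $ (w ! k) $ m * B $ m $ (x ! k)" for x])
  finally show "tensor_map A (tensor_map B a) w = tensor_map (A ** B) a w" .
qed

lemma tensor_map_elem_tensor:
  "tensor_map A (elem_tensor vs) = elem_tensor (map ((*v) A) vs)"
proof
  fix w
  show "tensor_map A (elem_tensor vs) w = elem_tensor (map ((*v) A) vs) w"
  proof (cases "length w = length vs")
    case True
    have "tensor_map A (elem_tensor vs) w =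
        (\<Sum>u | length u = length vs. \<Prod>k<length vs. A $ (w ! k) $ (u ! k) * (vs ! k) $ (u ! k))"
      unfolding tensor_map_def elem_tensor_def True by (simp add: prod.distrib)
    also have "\<dots> = (\<Prod>k<length vs. (A *v (vs ! k)) $ (w ! k))"
      by (simp add: sum_words_prod[where f = "\<lambda>k m. A $ (w ! k) $ m * (vs ! k) $ m"]
          matrix_vector_mult_def)
    finally show ?thesis by (simp add: elem_tensor_def True)
  qed (simp add: tensor_map_def elem_tensor_def)
qed

lemma tensor_map_sum:
  "tensor_map A (\<lambda>w. \<Sum>x\<in>X. f x w) = (\<lambda>w. \<Sum>x\<in>X. tensor_map A (f x) w)"
  unfolding tensor_map_def by (simp add: sum_distrib_left sum.swap[of _ X])

lemma tensor_map_scale: "tensor_map A (\<lambda>w. c * a w) = (\<lambda>w. c * tensor_map A a w)"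
  unfolding tensor_map_def by (simp add: sum_distrib_left mult_ac)

lemma tensor_map_add:
  "tensor_map A (\<lambda>w. a w + b w) = (\<lambda>w. tensor_map A a w + tensor_map A b w)"
  unfolding tensor_map_def by (simp add: distrib_left sum.distrib)

lemma tensor_map_homogeneous_part:
  "tensor_map A (homogeneous_part n a) = homogeneous_part n (tensor_map A a)"
  by (auto simp: tensor_map_def homogeneous_part_def intro!: sum.neutral)

text \<open>
  If the columns of \<open>E\<close> form a basis, then \<open>tensor_map D a\<close> lists the coordinates of \<open>a\<close> in the induced
  basis of the tensor algebra. This is functoriality applied to \<open>E ** D = mat 1\<close>.
\<close>

lemma basis_expansion:
  assumes "E ** D = mat 1"
  shows "a w = (\<Sum>u | length u = length w.
           tensor_map D a u * elem_tensor (map (\<lambda>m. column m E) u) w)"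
proof -
  have "a w = tensor_map E (tensor_map D a) w"
    by (simp add: tensor_map_comp assms tensor_map_id)
  also have "\<dots> = (\<Sum>u | length u = length w.
           tensor_map D a u * elem_tensor (map (\<lambda>m. column m E) u) w)"
    unfolding tensor_map_def[of E] elem_tensor_def column_def
    by (intro sum.cong) (auto simp: mult.commute)
  finally show ?thesis .
qed

section \<open>Symmetrization\<close>

lemma permute_list_inverse:
  assumes "\<sigma> permutes {..<length u}"
  shows "permute_list \<sigma> (permute_list (inv \<sigma>) u) = u"
    and "permute_list (inv \<sigma>) (permute_list \<sigma> u) = u"
proof -
  show "permute_list \<sigma> (permute_list (inv \<sigma>) u) = u"
    using permute_list_compose[OF assms, of "inv \<sigma>"] permutes_inv_o[OF assms] by simp
  show "permute_list (inv \<sigma>) (permute_list \<sigma> u) = u"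
    using permute_list_compose[OF permutes_inv[OF assms], of \<sigma>] permutes_inv_o[OF assms] by simp
qed

lemma bij_betw_permute_list:
  assumes "\<sigma> permutes {..<n}"
  shows "bij_betw (permute_list \<sigma>) {u. length u = n} {u. length u = n}"
  by (rule bij_betw_byWitness[where f' = "permute_list (inv \<sigma>)"])
     (use assms permute_list_inverse in auto)

lemma tensor_map_permute:
  assumes \<sigma>: "\<sigma> permutes {..<length w}"
  shows "tensor_map A a (permute_list \<sigma> w) = tensor_map A (\<lambda>u. a (permute_list \<sigma> u)) w"
proof -
  let ?W = "{u :: 'a list. length u = length w}"
  have "tensor_map A a (permute_list \<sigma> w) =
      (\<Sum>u\<in>?W. (\<Prod>k<length w. A $ (permute_list \<sigma> w ! k) $ (permute_list \<sigma> u ! k)) *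
         a (permute_list \<sigma> u))"
    unfolding tensor_map_def
    using sum.reindex_bij_betw[OF bij_betw_permute_list[OF \<sigma>],
        of "\<lambda>u. (\<Prod>k<length w. A $ (permute_list \<sigma> w ! k) $ (u ! k)) * a u"] by simp
  moreover have "(\<Prod>k<length w. A $ (permute_list \<sigma> w ! k) $ (permute_list \<sigma> u ! k)) =
      (\<Prod>k<length w. A $ (w ! k) $ (u ! k))" if "u \<in> ?W" for u
  proof -
    have "(\<Prod>k<length w. A $ (permute_list \<sigma> w ! k) $ (permute_list \<sigma> u ! k)) =
        (\<Prod>k<length w. A $ (w ! \<sigma> k) $ (u ! \<sigma> k))"
      using that \<sigma> by (intro prod.cong) (auto simp: permute_list_nth)
    then show ?thesis
      using prod.reindex_bij_betw[OF permutes_imp_bij[OF \<sigma>],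
          of "\<lambda>k. A $ (w ! k) $ (u ! k)"] by simp
  qed
  ultimately show ?thesis unfolding tensor_map_def by simp
qed

lemma tensor_map_symmetrize: "tensor_map A (symmetrize a) = symmetrize (tensor_map A a)"
proof
  fix w :: "'a list"
  let ?P = "{\<sigma>. \<sigma> permutes {..<length w}}"
  have "tensor_map A (symmetrize a) w =
      tensor_map A (\<lambda>u. inverse (fact (length w)) * (\<Sum>\<sigma>\<in>?P. a (permute_list \<sigma> u))) w"
    by (simp add: tensor_map_def symmetrize_def field_simps)
  also have "\<dots> =
      inverse (fact (length w)) * (\<Sum>\<sigma>\<in>?P. tensor_map A (\<lambda>u. a (permute_list \<sigma> u)) w)"
    by (simp only: tensor_map_scale tensor_map_sum)
  also have "\<dots> = symmetrize (tensor_map A a) w"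
    by (simp add: symmetrize_def tensor_map_permute field_simps)
  finally show "tensor_map A (symmetrize a) w = symmetrize (tensor_map A a) w" .
qed

lemma symmetrize_permute:
  assumes "\<sigma> permutes {..<length w}"
  shows "symmetrize a (permute_list \<sigma> w) = symmetrize a w"
proof -
  have "(\<Sum>\<tau> | \<tau> permutes {..<length w}. a (permute_list \<tau> (permute_list \<sigma> w))) =
      (\<Sum>\<tau> | \<tau> permutes {..<length w}. a (permute_list (\<sigma> \<circ> \<tau>) w))"
    by (intro sum.cong) (auto simp: permute_list_compose)
  then show ?thesis
    using setum_permutations_compose_left[OF assms, of "\<lambda>\<tau>. a (permute_list \<tau> w)"]
    by (simp add: symmetrize_def)
qed

text \<open>
  The embedding of the symmetric group on the last \<open>n - k\<close> positions into that on all \<open>n\<close> positions.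
\<close>

lemma permutes_drop:
  fixes k n :: nat
  assumes \<tau>: "\<tau> permutes {..<n - k}" and k: "k \<le> n"
  shows "(\<lambda>i. if i < k then i else k + \<tau> (i - k)) permutes {..<n}" (is "?s permutes _")
proof (rule bij_imp_permutes)
  have "i = j" if "?s i = ?s j" for i j
    using inj_eq[OF permutes_inj[OF \<tau>], of "i - k" "j - k"] that
    by (simp split: if_splits)
  then have inj: "inj ?s" by (rule injI)
  have "\<tau> (i - k) < n - k" if "\<not> i < k" "i < n" for i
    using permutes_in_image[OF \<tau>, of "i - k"] that by auto
  then have "?s i < n" if "i < n" for i
    using that k by (cases "i < k") (auto simp: less_diff_conv add.commute)
  then have "?s ` {..<n} \<subseteq> {..<n}" by blast
  then show "bij_betw ?s {..<n} {..<n}"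
    using endo_inj_surj[of "{..<n}" ?s] inj_on_subset[OF inj subset_UNIV] by (simp add: bij_betw_def)
  fix x assume "x \<notin> {..<n}"
  then show "?s x = x" using permutes_not_in[OF \<tau>, of "x - k"] k by auto
qed

lemma permute_list_drop:
  assumes "\<tau> permutes {..<length w - k}" and "k \<le> length w"
  shows "permute_list (\<lambda>i. if i < k then i else k + \<tau> (i - k)) w
    = take k w @ permute_list \<tau> (drop k w)"
  using assms by (intro nth_equalityI)
    (auto simp: permute_list_nth permutes_drop nth_append permutes_in_image)

text \<open>
  A permutation of the last \<open>n - k\<close> letters is in particular a permutation of all \<open>n\<close> letters, so the
  outer average absorbs the inner one. Consequently an iterated symmetric product needs only one
  symmetrization, at the end.
\<close>

lemma symmetrize_tensor_prod_symmetrize: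
  "symmetrize (tensor_prod a (symmetrize b)) = symmetrize (tensor_prod a b)"
proof
  fix w :: "'a list"
  define n where "n = length w"
  let ?P = "\<lambda>n. {\<sigma>. \<sigma> permutes {..<n}}"
  have "(\<Sum>\<sigma>\<in>?P n. a (take k (permute_list \<sigma> w)) * symmetrize b (drop k (permute_list \<sigma> w))) =
      (\<Sum>\<sigma>\<in>?P n. a (take k (permute_list \<sigma> w)) * b (drop k (permute_list \<sigma> w)))"
    (is "?L = ?R") if k: "k \<le> n" for k
  proof -
    have inner: "(\<Sum>\<sigma>\<in>?P n. a (take k (permute_list \<sigma> w)) *
        b (permute_list \<tau> (drop k (permute_list \<sigma> w)))) = ?R" if \<tau>: "\<tau> \<in> ?P (n - k)" for \<tau>
    proof -
      let ?s = "\<lambda>i. if i < k then i else k + \<tau> (i - k)"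
      have s: "?s permutes {..<n}" using permutes_drop \<tau> k by blast
      have "a (take k (permute_list \<sigma> w)) * b (permute_list \<tau> (drop k (permute_list \<sigma> w))) =
          a (take k (permute_list (\<sigma> \<circ> ?s) w)) * b (drop k (permute_list (\<sigma> \<circ> ?s) w))"
        if "\<sigma> \<in> ?P n" for \<sigma>
      proof -
        have "permute_list (\<sigma> \<circ> ?s) w =
            take k (permute_list \<sigma> w) @ permute_list \<tau> (drop k (permute_list \<sigma> w))"
          using permute_list_compose[of ?s w \<sigma>] permute_list_drop[of \<tau> "permute_list \<sigma> w" k] \<tau> k s
          by (simp add: n_def)
        then show ?thesis using k by (simp add: n_def)
      qed
      then show ?thesis
        using sum_permutations_compose_right[OF s,
            of "\<lambda>\<sigma>. a (take k (permute_list \<sigma> w)) * b (drop k (permute_list \<sigma> w))"]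
        by simp
    qed
    \<comment> \<open>the sum over \<open>\<sigma>\<close> does not depend on \<open>\<tau>\<close>, so averaging over \<open>\<tau>\<close> has no effect\<close>
    have "?L = (\<Sum>\<tau>\<in>?P (n - k). \<Sum>\<sigma>\<in>?P n. a (take k (permute_list \<sigma> w)) *
        b (permute_list \<tau> (drop k (permute_list \<sigma> w)))) / fact (n - k)"
      by (subst sum.swap)
         (simp add: symmetrize_def n_def sum_distrib_left sum_divide_distrib)
    also have "\<dots> = of_nat (card (?P (n - k))) * ?R / fact (n - k)"
      by (simp add: inner)
    also have "\<dots> = ?R"
      by (simp add: card_permutations[OF refl])
    finally show ?thesis .
  qed
  moreover have "symmetrize (tensor_prod a c) w = (\<Sum>k\<le>n. \<Sum>\<sigma>\<in>?P n.
      a (take k (permute_list \<sigma> w)) * c (drop k (permute_list \<sigma> w))) / fact n" for c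
    by (subst sum.swap) (simp add: symmetrize_def tensor_prod_def n_def)
  ultimately show "symmetrize (tensor_prod a (symmetrize b)) w = symmetrize (tensor_prod a b) w"
    by simp
qed

lemma tensor_prod_elem_tensor:
  "tensor_prod (elem_tensor [v]) (elem_tensor vs) = elem_tensor (v # vs)"
proof
  fix w
  show "tensor_prod (elem_tensor [v]) (elem_tensor vs) w = elem_tensor (v # vs) w"
  proof (cases w)
    case (Cons m u)
    have "tensor_prod (elem_tensor [v]) (elem_tensor vs) w =
        (\<Sum>k\<in>{1}. elem_tensor [v] (take k w) * elem_tensor vs (drop k w))"
      unfolding tensor_prod_def
      by (rule sum.mono_neutral_right) (auto simp: Cons elem_tensor_def)
    also have "\<dots> = elem_tensor (v # vs) w"
      by (simp add: Cons elem_tensor_def prod.lessThan_Suc_shift del: prod.lessThan_Suc)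
    finally show ?thesis .
  qed (simp add: tensor_prod_def elem_tensor_def)
qed

lemma sym_prod_list_eq: "sym_prod_list vs = symmetrize (elem_tensor vs)"
proof (induction vs)
  case Nil
  have "elem_tensor [] w = symmetrize (elem_tensor []) w" for w :: "'a list"
  proof (cases "w = []")
    case False
    then have "permute_list \<sigma> w \<noteq> []" for \<sigma>
      by (metis length_0_conv length_permute_list)
    then show ?thesis using False by (simp add: symmetrize_def elem_tensor_def)
  qed (simp add: symmetrize_def)
  then have "elem_tensor [] = symmetrize (elem_tensor [] :: 'a tensor)" ..
  then show ?case by (simp add: sym_prod_list_def)
next
  case (Cons v vs)
  have "sym_prod_list (v # vs) = symmetrize (tensor_prod (elem_tensor [v]) (sym_prod_list vs))"
    by (simp add: sym_prod_list_def sym_prod_def)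
  then show ?case
    by (simp add: Cons symmetrize_tensor_prod_symmetrize tensor_prod_elem_tensor)
qed

text \<open>
  The symmetrization is constant on the rearrangements of \<open>w\<close> and zero elsewhere, and averaging keeps
  the total mass 1. Hence the constant is the reciprocal of the number of rearrangements, which is a
  multinomial coefficient.
\<close>

lemma symmetrize_single_word:
  fixes w :: "'m::finite list"
  shows "symmetrize (\<lambda>u. if u = w then 1 else 0) v =
    (if mset v = mset w then (\<Prod>m\<in>UNIV. fact (count (mset w) m)) / fact (length w) else 0)"
    (is "?f v = _")
proof (cases "mset v = mset w")
  case False
  then have "permute_list \<sigma> v \<noteq> w" if "\<sigma> permutes {..<length v}" for \<sigma>
    using that mset_permute_list by metis
  then show ?thesis using False by (simp add: symmetrize_def)
next
  case True
  let ?P = "permutations_of_multiset (mset w)" and ?W = "{u :: 'm list. length u = length w}"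
  have const: "?f u = ?f w" if "u \<in> ?P" for u
  proof -
    have "mset u = mset w" using that by (simp add: permutations_of_multiset_def)
    then obtain \<sigma> where "\<sigma> permutes {..<length w}" "permute_list \<sigma> w = u"
      by (rule mset_eq_permutation)
    then show ?thesis using symmetrize_permute by blast
  qed
  have "of_nat (card ?P) * ?f w = (\<Sum>u\<in>?P. ?f u)" using const by simp
  also have "\<dots> = (\<Sum>u\<in>?W. ?f u)"
  proof (rule sum.mono_neutral_left)
    show "?P \<subseteq> ?W"
      using mset_eq_length by (auto simp: permutations_of_multiset_def)
    show "\<forall>u\<in>?W - ?P. ?f u = 0"
    proof
      fix u assume u: "u \<in> ?W - ?P"
      then have "mset u \<noteq> mset w" by (auto simp: permutations_of_multiset_def)
      then have "permute_list \<sigma> u \<noteq> w" if "\<sigma> permutes {..<length u}" for \<sigma>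
        using that mset_permute_list by metis
      then show "?f u = 0" by (simp add: symmetrize_def)
    qed
  qed simp
  also have "\<dots> = (\<Sum>\<sigma> | \<sigma> permutes {..<length w}.
      \<Sum>u\<in>?W. if permute_list \<sigma> u = w then 1 else 0) / fact (length w)"
    by (subst sum.swap) (simp add: symmetrize_def sum_divide_distrib)
  \<comment> \<open>each \<open>\<sigma>\<close> moves exactly one word to \<open>w\<close>\<close>
  also have "\<dots> = 1"
  proof -
    have "(\<Sum>u\<in>?W. if permute_list \<sigma> u = w then 1 else 0) = (1::complex)"
      if "\<sigma> permutes {..<length w}" for \<sigma>
      using sum.reindex_bij_betw[OF bij_betw_permute_list[OF that],
          of "\<lambda>u. if u = w then 1 else (0::complex)"] by (simp add: sum.delta)
    then show ?thesis by (simp add: card_permutations[OF refl])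
  qed
  finally have "of_nat (card ?P) * ?f w = 1" .
  moreover have "card ?P * (\<Prod>m\<in>UNIV. fact (count (mset w) m)) = fact (length w)"
  proof -
    have "(\<Prod>m\<in>UNIV. fact (count M m)) = (\<Prod>m\<in>set_mset M. fact (count M m) :: nat)"
      for M :: "'m multiset"
      by (rule prod.mono_neutral_right) (auto simp: not_in_iff)
    then show ?thesis using card_permutations_of_multiset_aux[of "mset w"] by simp
  qed
  from arg_cong[OF this, of "of_nat :: nat \<Rightarrow> complex"]
  have "of_nat (card ?P) * (\<Prod>m\<in>UNIV. fact (count (mset w) m)) = (fact (length w) :: complex)"
    by simp
  ultimately have "(\<Prod>m\<in>UNIV. fact (count (mset w) m)) = ?f w * fact (length w)"
    using mult.assoc[of "?f w" "of_nat (card ?P)" "\<Prod>m\<in>UNIV. fact (count (mset w) m)"]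
    by (simp only: mult.commute[of "?f w" "of_nat (card ?P)"] mult_1_left)
  then have "?f w = (\<Prod>m\<in>UNIV. fact (count (mset w) m)) / fact (length w)"
    by (metis fact_nonzero nonzero_mult_div_cancel_right)
  then show ?thesis using const[of v] True by (simp add: permutations_of_multiset_def)
qed

section \<open>Taylor coefficients as coordinates in the basis of complex coordinates\<close>

text \<open>
  The complex coordinates as the columns of a matrix, with \<open>Inl k\<close> indexing \<open>z\<^sup>k\<close> and \<open>Inr k\<close>
  indexing its conjugate. The rows of \<open>z_dual\<close> are the dual linear forms: since
  \<open>\<alpha> z\<^sup>k + \<beta> zbar\<^sup>k = (\<alpha> + \<beta>) x\<^sup>k + \<i> (\<alpha> - \<beta>) y\<^sup>k\<close>, the coefficients of \<open>v\<close> are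
  \<open>\<alpha> = (v\<^sub>x - \<i> v\<^sub>y) / 2\<close> and \<open>\<beta> = (v\<^sub>x + \<i> v\<^sub>y) / 2\<close>.
\<close>

definition z_basis :: "complex ^ ('d::finite + 'd) ^ ('d + 'd)" where
  "z_basis = (\<chi> i m. case m of Inl k \<Rightarrow> z_coord k $ i | Inr k \<Rightarrow> zbar_coord k $ i)"

definition z_dual :: "complex ^ ('d::finite + 'd) ^ ('d + 'd)" where
  "z_dual = (\<chi> m i. case m of
       Inl k \<Rightarrow> (axis (Inl k) 1 $ i - \<i> * axis (Inr k) 1 $ i) / 2
     | Inr k \<Rightarrow> (axis (Inl k) 1 $ i + \<i> * axis (Inr k) 1 $ i) / 2)"

lemma column_z_basis:
  "column (Inl k) z_basis = z_coord k" "column (Inr k) z_basis = zbar_coord k"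
  by (simp_all add: column_def z_basis_def vec_eq_iff)

lemma sum_axis: "(\<Sum>i\<in>UNIV. axis j (1::complex) $ i * f i) = f j"
proof -
  have "(\<Sum>i\<in>UNIV. axis j (1::complex) $ i * f i) = (\<Sum>i\<in>UNIV. if i = j then f i else 0)"
    by (intro sum.cong) (auto simp: axis_def)
  then show ?thesis by (simp add: sum.delta)
qed

lemma z_dual_vector:
  "(z_dual *v v) $ Inl k = (v $ Inl k - \<i> * v $ Inr k) / 2"
  "(z_dual *v v) $ Inr k = (v $ Inl k + \<i> * v $ Inr k) / 2"
  by (simp_all add: matrix_vector_mult_def z_dual_def left_diff_distrib distrib_right mult.assoc
      sum_subtractf sum.distrib sum_axis flip: sum_divide_distrib sum_distrib_left)

lemma z_dual_column: "z_dual *v column m z_basis = axis m 1"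
proof -
  have "(z_dual *v column m z_basis) $ j = axis m 1 $ j" for j
    by (cases m; cases j)
       (auto simp: column_z_basis z_dual_vector z_coord_def zbar_coord_def axis_def)
  then show ?thesis by (simp add: vec_eq_iff)
qed

lemma z_dual_z_basis: "z_dual ** z_basis = mat 1"
proof -
  have "(z_dual ** z_basis) $ i $ m = (z_dual *v column m z_basis) $ i" for i m :: "'a + 'a"
    by (simp add: matrix_matrix_mult_def matrix_vector_mult_def column_def)
  then show ?thesis by (auto simp: z_dual_column vec_eq_iff axis_def mat_def)
qed

lemma z_basis_z_dual: "z_basis ** z_dual = mat 1"
  using z_dual_z_basis matrix_left_right_inverse by blast

text \<open>
  The letters come in the order of the factors of \<open>monomial I J\<close>, so that the monomial is the
  symmetrization of the elementary tensor read off from this word. A word is determined up to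
  rearrangement by its \<open>mi_type\<close>, and \<open>mi_word\<close> picks one representative of every type.
\<close>

definition mi_word :: "'d::{finite,linorder} multiindex \<times> 'd multiindex \<Rightarrow> ('d + 'd) list" where
  "mi_word IJ =
     concat (map (\<lambda>k. replicate (fst IJ k) (Inl k)) (sorted_list_of_set UNIV)) @
     concat (map (\<lambda>k. replicate (snd IJ k) (Inr k)) (sorted_list_of_set UNIV))"

definition mi_type :: "('d + 'd) list \<Rightarrow> 'd multiindex \<times> 'd multiindex" where
  "mi_type u = (\<lambda>k. count (mset u) (Inl k), \<lambda>k. count (mset u) (Inr k))"

lemma mi_type_eq_iff: "mi_type u = mi_type v \<longleftrightarrow> mset u = mset v"
proof
  assume eq: "mi_type u = mi_type v"
  show "mset u = mset v"
  proof (rule multiset_eqI)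
    fix m show "count (mset u) m = count (mset v) m"
      using eq by (cases m) (auto simp: mi_type_def fun_eq_iff)
  qed
qed (simp add: mi_type_def)

lemma count_concat_replicate:
  fixes I :: "'d::{finite,linorder} \<Rightarrow> nat"
  shows "count (mset (concat (map (\<lambda>k. replicate (I k) (f k)) (sorted_list_of_set UNIV)))) y =
    (\<Sum>k\<in>UNIV. if f k = y then I k else 0)"
proof -
  have "count (mset (concat (map (\<lambda>k. replicate (I k) (f k)) xs))) y =
      (\<Sum>k\<leftarrow>xs. if f k = y then I k else 0)" for xs
    by (induction xs) auto
  then show ?thesis by (simp add: sum_list_distinct_conv_sum_set)
qed

lemma mi_type_mi_word [simp]: "mi_type (mi_word IJ) = IJ"
  by (simp add: mi_type_def mi_word_def count_concat_replicate sum.delta)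

lemma mset_mi_word: "mset (mi_word (mi_type u)) = mset u"
  using mi_type_eq_iff mi_type_mi_word by blast

lemma length_mi_word: "length (mi_word (I, J)) = mi_size (\<lambda>k. I k + J k)"
  by (simp add: mi_word_def mi_size_def length_concat comp_def sum.distrib
      sum_list_distinct_conv_sum_set)

lemma prod_fact_count_mi_word:
  "(\<Prod>m\<in>UNIV. fact (count (mset (mi_word (I, J))) m)) = (of_nat (mi_fact I * mi_fact J) :: complex)"
proof -
  have "count (mset (mi_word (I, J))) (Inl k) = I k" "count (mset (mi_word (I, J))) (Inr k) = J k" for k
    using mi_type_mi_word[of "(I, J)"] by (auto simp: mi_type_def fun_eq_iff)
  moreover have "(\<Prod>m\<in>UNIV. g m) = (\<Prod>k\<in>UNIV. g (Inl k)) * (\<Prod>k\<in>UNIV. g (Inr k))"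
    for g :: "'a + 'a \<Rightarrow> complex"
    by (simp add: UNIV_Plus_UNIV[symmetric] prod.Plus del: UNIV_Plus_UNIV)
  ultimately show ?thesis by (simp add: mi_fact_def)
qed

text \<open>
  In the basis of complex coordinates a monomial is the average of the rearrangements of a single
  word, and there are \<open>n! / (I! J!)\<close> of these.
\<close>

lemma tensor_map_monomial:
  "tensor_map z_dual (monomial I J) u =
    (if mi_type u = (I, J) then of_nat (mi_fact I * mi_fact J) / fact (length u) else 0)"
proof -
  have "mi_factors z_coord I @ mi_factors zbar_coord J = map (\<lambda>m. column m z_basis) (mi_word (I, J))"
    by (simp add: mi_factors_def mi_word_def map_concat comp_def column_z_basis)
  then have "tensor_map z_dual (monomial I J) =
      symmetrize (elem_tensor (map (\<lambda>m. axis m 1) (mi_word (I, J))))"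
    by (simp add: monomial_def sym_prod_list_eq tensor_map_symmetrize tensor_map_elem_tensor
        comp_def z_dual_column)
  also have "elem_tensor (map (\<lambda>m. axis m 1) w) = (\<lambda>u. if u = w then 1 else 0)"
    for w :: "('a + 'a) list"
    by (auto simp: elem_tensor_def axis_def fun_eq_iff list_eq_iff_nth_eq intro!: prod_zero)
  finally have "tensor_map z_dual (monomial I J) u =
      (if mset u = mset (mi_word (I, J)) then of_nat (mi_fact I * mi_fact J) / fact (length (mi_word (I, J))) else 0)"
    by (simp only: symmetrize_single_word prod_fact_count_mi_word)
  moreover have "mset u = mset (mi_word (I, J)) \<longleftrightarrow> mi_type u = (I, J)"
    by (metis mi_type_eq_iff mi_type_mi_word)
  ultimately show ?thesis using mset_eq_length[of u "mi_word (I, J)"] by simp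
qed

text \<open>
  The factors \<open>I! J!\<close> of the Taylor expansion cancel those in the coordinates of the monomials: each
  word of type \<open>(I, J)\<close> receives the same coordinate \<open>c\<^sub>I\<^sub>J / n!\<close>.
\<close>

lemma tensor_map_taylor_sum:
  assumes "finite {IJ. c IJ \<noteq> 0}"
  shows "tensor_map z_dual (\<lambda>w. \<Sum>(I, J) | c (I, J) \<noteq> 0.
      c (I, J) * monomial I J w / of_nat (mi_fact I * mi_fact J)) u = c (mi_type u) / fact (length u)"
proof -
  have fact_nz: "of_nat (mi_fact I * mi_fact J) \<noteq> (0::complex)" for I J :: "'a multiindex"
    by (simp add: mi_fact_def)
  have "tensor_map z_dual (\<lambda>w. \<Sum>(I, J) | c (I, J) \<noteq> 0.
      c (I, J) * monomial I J w / of_nat (mi_fact I * mi_fact J)) u =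
    tensor_map z_dual (\<lambda>w. \<Sum>IJ | c IJ \<noteq> 0.
      (c IJ / of_nat (mi_fact (fst IJ) * mi_fact (snd IJ))) * monomial (fst IJ) (snd IJ) w) u"
    by (simp add: case_prod_unfold)
  also have "\<dots> = (\<Sum>IJ | c IJ \<noteq> 0. if IJ = mi_type u then c IJ / fact (length u) else 0)"
    unfolding tensor_map_sum tensor_map_scale tensor_map_monomial
    by (intro sum.cong) (use fact_nz in auto)
  also have "\<dots> = c (mi_type u) / fact (length u)"
    using assms by (simp add: sum.delta)
  finally show ?thesis .
qed

lemma tensor_map_symmetric:
  assumes "a \<in> sym_algebra" "mset u = mset v"
  shows "tensor_map A a u = tensor_map A a v"
proof -
  obtain \<sigma> where \<sigma>: "\<sigma> permutes {..<length v}" "permute_list \<sigma> v = u"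
    using mset_eq_permutation[OF assms(2)] .
  have "tensor_map A (\<lambda>u. a (permute_list \<sigma> u)) v = tensor_map A a v"
    unfolding tensor_map_def
    by (intro sum.cong) (use assms(1) \<sigma> in \<open>auto simp: sym_algebra_def\<close>)
  then show ?thesis using tensor_map_permute[OF \<sigma>(1)] \<sigma>(2) by metis
qed

lemma sym_algebra_degree_bound:
  assumes "a \<in> sym_algebra"
  obtains N where "\<And>w. length w \<ge> N \<Longrightarrow> a w = 0"
proof -
  have "finite (length ` {w. a w \<noteq> 0})" using assms by (simp add: sym_algebra_def)
  then obtain N where "\<forall>n\<in>length ` {w. a w \<noteq> 0}. n < N"
    using finite_nat_set_iff_bounded by blast
  then show ?thesis by (intro that[of N]) force
qed

lemma finite_support_tensor_map:
  assumes "a \<in> sym_algebra"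
  shows "finite {u. tensor_map A a u \<noteq> 0}"
proof -
  obtain N where N: "\<And>w. length w \<ge> N \<Longrightarrow> a w = 0"
    using sym_algebra_degree_bound[OF assms] by blast
  have "tensor_map A a u = 0" if "length u \<ge> N" for u
    using that N by (auto simp: tensor_map_def intro!: sum.neutral)
  then have "{u. tensor_map A a u \<noteq> 0} \<subseteq> {u. set u \<subseteq> UNIV \<and> length u \<le> N}"
    by (auto intro: ccontr)
  then show ?thesis by (rule finite_subset) (rule finite_lists_length_le[OF finite])
qed

text \<open>
  By the preceding computation a Taylor expansion of \<open>a\<close> with coefficients \<open>c\<close> forces
  \<open>c\<^sub>I\<^sub>J = n! \<cdot> (coordinate of a at a word of type (I, J))\<close>, which gives uniqueness. Conversely the
  coefficients so defined reproduce all coordinates of \<open>a\<close>, because these depend only on the type of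
  the word when \<open>a\<close> is symmetric.
\<close>

lemma taylor_coeff:
  fixes a :: "('d::{finite,linorder} + 'd) tensor"
  assumes a: "a \<in> sym_algebra"
  shows "taylor_coeff a IJ = fact (length (mi_word IJ)) * tensor_map z_dual a (mi_word IJ)"
    and "finite {IJ. taylor_coeff a IJ \<noteq> 0}"
proof -
  define c0 where "c0 = (\<lambda>IJ. fact (length (mi_word IJ)) * tensor_map z_dual a (mi_word IJ))"
  let ?s = "\<lambda>c w. \<Sum>(I, J) | c (I, J) \<noteq> 0. c (I, J) * monomial I J w / of_nat (mi_fact I * mi_fact J) :: complex"
  have "finite (mi_word -` {u. tensor_map z_dual a u \<noteq> 0})"
    by (intro finite_vimageI finite_support_tensor_map a injI) (metis mi_type_mi_word)
  then have fin: "finite {IJ. c0 IJ \<noteq> 0}" by (simp add: vimage_def c0_def)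
  \<comment> \<open>existence: both tensors have the same coordinates in the basis of complex coordinates\<close>
  have "tensor_map z_dual (?s c0) = tensor_map z_dual a"
  proof
    fix u
    have "tensor_map z_dual (?s c0) u = c0 (mi_type u) / fact (length u)"
      by (rule tensor_map_taylor_sum[OF fin])
    also have "\<dots> = tensor_map z_dual a u"
      using tensor_map_symmetric[OF a mset_mi_word, of z_dual u] mset_eq_length[OF mset_mi_word[of u]]
      by (simp add: c0_def)
    finally show "tensor_map z_dual (?s c0) u = tensor_map z_dual a u" .
  qed
  then have "tensor_map z_basis (tensor_map z_dual (?s c0)) = tensor_map z_basis (tensor_map z_dual a)"
    by simp
  then have rep: "a = ?s c0" by (simp only: tensor_map_comp z_basis_z_dual tensor_map_id)
  have "taylor_coeff a = c0"
    unfolding taylor_coeff_def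
  proof (rule the_equality)
    \<comment> \<open>uniqueness: evaluate the coordinates of \<open>a\<close> at the representative words\<close>
    fix c assume c: "finite {IJ. c IJ \<noteq> 0} \<and> a = ?s c"
    from arg_cong[OF conjunct2[OF c], of "tensor_map z_dual"]
    have "tensor_map z_dual a u = c (mi_type u) / fact (length u)" for u
      by (simp only: tensor_map_taylor_sum[OF conjunct1[OF c]])
    then show "c = c0" by (intro ext) (simp add: c0_def)
  qed (rule conjI[OF fin rep])
  then show "taylor_coeff a IJ = fact (length (mi_word IJ)) * tensor_map z_dual a (mi_word IJ)"
    "finite {IJ. taylor_coeff a IJ \<noteq> 0}"
    using fin by (simp_all add: c0_def)
qed

section \<open>The supremum norms of the coefficients\<close>

lemma coeff_norm_eq:
  assumes a: "a \<in> sym_algebra"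
  shows "coeff_norm \<epsilon> a = (SUP IJ. fact (length (mi_word IJ)) *
    cmod (tensor_map z_dual a (mi_word IJ)) / fact (length (mi_word IJ)) powr \<epsilon>)"
proof -
  have "(case IJ of (I, J) \<Rightarrow> cmod (taylor_coeff a (I, J)) / fact (mi_size (\<lambda>k. I k + J k)) powr \<epsilon>) =
    fact (length (mi_word IJ)) *
    cmod (tensor_map z_dual a (mi_word IJ)) / fact (length (mi_word IJ)) powr \<epsilon>" for IJ
    by (cases IJ) (simp add: taylor_coeff(1)[OF a] norm_mult flip: length_mi_word)
  then show ?thesis unfolding coeff_norm_def by presburger
qed

text \<open>
  This and \<open>coeff_norm_least\<close> characterize \<open>coeff_norm \<epsilon> a\<close> as the smallest \<open>B\<close> with
  \<open>n! |a\<^sub>u| \<le> B n!\<^sup>\<epsilon>\<close> for all words \<open>u\<close> of any length \<open>n\<close>, where \<open>a\<^sub>u\<close> is the coordinate of \<open>a\<close>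
  at \<open>u\<close>. Only this characterization is used below. The supremum is finite since only finitely many
  coefficients are nonzero.
\<close>

lemma coeff_norm_upper:
  assumes a: "a \<in> sym_algebra"
  shows "fact (length u) * cmod (tensor_map z_dual a u) \<le> coeff_norm \<epsilon> a * fact (length u) powr \<epsilon>"
proof -
  define f where "f IJ = fact (length (mi_word IJ)) *
    cmod (tensor_map z_dual a (mi_word IJ)) / fact (length (mi_word IJ)) powr \<epsilon>" for IJ
  have "f IJ = 0" if "taylor_coeff a IJ = 0" for IJ
    using that by (simp add: f_def taylor_coeff(1)[OF a])
  then have "range f \<subseteq> insert 0 (f ` {IJ. taylor_coeff a IJ \<noteq> 0})" by blast
  then have "finite (range f)"
    by (rule finite_subset) (simp add: taylor_coeff(2)[OF a])
  then have "f (mi_type u) \<le> coeff_norm \<epsilon> a"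
    unfolding coeff_norm_eq[OF a] f_def[symmetric] by (intro cSUP_upper bdd_above_finite) auto
  moreover have "f (mi_type u) =
      fact (length u) * cmod (tensor_map z_dual a u) / fact (length u) powr \<epsilon>"
    unfolding f_def tensor_map_symmetric[OF a mset_mi_word] mset_eq_length[OF mset_mi_word] ..
  ultimately show ?thesis by (simp add: divide_le_eq)
qed

lemma coeff_norm_least:
  assumes a: "a \<in> sym_algebra"
    and B: "\<And>u. fact (length u) * cmod (tensor_map z_dual a u) \<le> B * fact (length u) powr \<epsilon>"
  shows "coeff_norm \<epsilon> a \<le> B"
  unfolding coeff_norm_eq[OF a] by (intro cSUP_least) (use B in \<open>auto simp: divide_le_eq\<close>)

lemma sym_algebra_add:
  assumes "a \<in> sym_algebra" "b \<in> sym_algebra"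
  shows "(\<lambda>w. a w + b w) \<in> sym_algebra"
proof -
  have "{w. a w + b w \<noteq> 0} \<subseteq> {w. a w \<noteq> 0} \<union> {w. b w \<noteq> 0}" by auto
  then have "finite {w. a w + b w \<noteq> 0}"
    by (rule finite_subset) (use assms in \<open>simp add: sym_algebra_def\<close>)
  then show ?thesis using assms unfolding sym_algebra_def by simp
qed

lemma sym_algebra_diff:
  assumes "a \<in> sym_algebra" "b \<in> sym_algebra"
  shows "(\<lambda>w. a w - b w) \<in> sym_algebra"
proof -
  have "{w. a w - b w \<noteq> 0} \<subseteq> {w. a w \<noteq> 0} \<union> {w. b w \<noteq> 0}" by auto
  then have "finite {w. a w - b w \<noteq> 0}"
    by (rule finite_subset) (use assms in \<open>simp add: sym_algebra_def\<close>)
  then show ?thesis using assms unfolding sym_algebra_def by simp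
qed

lemma coeff_norm_triangle:
  assumes a: "a \<in> sym_algebra" and b: "b \<in> sym_algebra"
  shows "coeff_norm \<epsilon> (\<lambda>w. a w + b w) \<le> coeff_norm \<epsilon> a + coeff_norm \<epsilon> b"
proof (rule coeff_norm_least[OF sym_algebra_add[OF a b]])
  fix u
  have "fact (length u) * cmod (tensor_map z_dual a u + tensor_map z_dual b u) \<le>
      fact (length u) * cmod (tensor_map z_dual a u) + fact (length u) * cmod (tensor_map z_dual b u)"
    using mult_left_mono[OF norm_triangle_ineq, of "fact (length u)"] by (simp add: distrib_left)
  then show "fact (length u) * cmod (tensor_map z_dual (\<lambda>w. a w + b w) u) \<le>
      (coeff_norm \<epsilon> a + coeff_norm \<epsilon> b) * fact (length u) powr \<epsilon>"
    using coeff_norm_upper[OF a, of u \<epsilon>] coeff_norm_upper[OF b, of u \<epsilon>]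
    by (simp add: tensor_map_add distrib_right)
qed

lemma coeff_norm_nonneg:
  assumes "a \<in> sym_algebra"
  shows "0 \<le> coeff_norm \<epsilon> a"
proof -
  have "cmod (tensor_map z_dual a []) \<le> coeff_norm \<epsilon> a"
    using coeff_norm_upper[OF assms, of "[]" \<epsilon>] by simp
  then show ?thesis by (rule order_trans[OF norm_ge_zero])
qed

lemma coeff_norm_zero: "coeff_norm \<epsilon> (\<lambda>w. 0) = 0"
proof (rule antisym)
  have zero: "(\<lambda>w. 0) \<in> sym_algebra" by (simp add: sym_algebra_def)
  show "coeff_norm \<epsilon> (\<lambda>w. 0) \<le> 0"
    by (rule coeff_norm_least[OF zero]) (simp add: tensor_map_def)
  show "0 \<le> coeff_norm \<epsilon> (\<lambda>w. 0)" by (rule coeff_norm_nonneg[OF zero])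
qed

section \<open>Projective tensor seminorms\<close>

lemma complex_seminorm_zero: "complex_seminorm p \<Longrightarrow> p 0 = 0"
  unfolding complex_seminorm_def by (metis mult_zero_left norm_zero vector_smult_lzero)

lemma complex_seminorm_nonneg:
  assumes "complex_seminorm p"
  shows "0 \<le> p x"
proof -
  have "p (x + (-1) *s x) \<le> p x + p ((-1) *s x)" "p ((-1) *s x) = cmod (-1) * p x"
    using assms unfolding complex_seminorm_def by blast+
  then show ?thesis using complex_seminorm_zero[OF assms] by simp
qed

text \<open>
  The values whose infimum is the projective tensor seminorm. The infimum is a meaningful one only
  if this set is nonempty and bounded below.
\<close>

definition decomposition_costs ::
    "(complex ^ 'm \<Rightarrow> real) \<Rightarrow> nat \<Rightarrow> 'm::finite tensor \<Rightarrow> real set" where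
  "decomposition_costs p n T = {(\<Sum>vs\<leftarrow>vss. \<Prod>v\<leftarrow>vs. p v) | vss.
     (\<forall>vs\<in>set vss. length vs = n) \<and> T = (\<lambda>w. \<Sum>vs\<leftarrow>vss. elem_tensor vs w)}"

lemma proj_seminorm_eq:
  "proj_seminorm p n T = (if n = 0 then cmod (T []) else Inf (decomposition_costs p n T))"
  by (simp add: proj_seminorm_def decomposition_costs_def)

lemma decomposition_costsI:
  assumes "x = (\<Sum>vs\<leftarrow>vss. \<Prod>v\<leftarrow>vs. p v)" "\<forall>vs\<in>set vss. length vs = n"
    "T = (\<lambda>w. \<Sum>vs\<leftarrow>vss. elem_tensor vs w)"
  shows "x \<in> decomposition_costs p n T"
  unfolding decomposition_costs_def by (intro CollectI exI[of _ vss] conjI assms)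

lemma decomposition_costsE:
  assumes "x \<in> decomposition_costs p n T"
  obtains vss where "x = (\<Sum>vs\<leftarrow>vss. \<Prod>v\<leftarrow>vs. p v)" "\<forall>vs\<in>set vss. length vs = n"
    "T = (\<lambda>w. \<Sum>vs\<leftarrow>vss. elem_tensor vs w)"
  using assms unfolding decomposition_costs_def by (elim CollectE exE conjE) (rule that)

lemma decomposition_costs_nonneg:
  assumes "complex_seminorm p" "x \<in> decomposition_costs p n T"
  shows "0 \<le> x"
  using assms complex_seminorm_nonneg[OF assms(1)]
  by (auto simp: decomposition_costs_def intro!: sum_list_nonneg prod_list_nonneg)

lemma bdd_below_decomposition_costs:
  "complex_seminorm p \<Longrightarrow> bdd_below (decomposition_costs p n T)"
  using decomposition_costs_nonneg by (intro bdd_belowI[of _ 0])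

text \<open>
  The decomposition is the expansion in a basis. The scalar coefficient is moved into the first tensor
  factor, which exists only in positive degree.
\<close>

lemma basis_decomposition_cost:
  fixes E D :: "complex ^ 'm::finite ^ 'm"
  assumes p: "complex_seminorm p" and n: "n > 0" and inverse: "E ** D = mat 1"
  shows "(\<Sum>u | length u = n. cmod (tensor_map D a u) * (\<Prod>m\<leftarrow>u. p (column m E)))
    \<in> decomposition_costs p n (homogeneous_part n a)"
proof -
  obtain us :: "'m list list" where us: "set us = {u. length u = n}" "distinct us"
    using finite_distinct_list[OF finite_words, of n] by (elim exE conjE) (rule that)
  let ?col = "\<lambda>m. column m E"
  define f where "f u = (tensor_map D a u *s ?col (hd u)) # map ?col (tl u)" for u
  have f: "length (f u) = n"
      "elem_tensor (f u) w = tensor_map D a u * elem_tensor (map ?col u) w"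
      "(\<Prod>v\<leftarrow>f u. p v) = cmod (tensor_map D a u) * (\<Prod>m\<leftarrow>u. p (?col m))"
    if "length u = n" for u w
  proof -
    obtain m v where u: "u = m # v" using \<open>length u = n\<close> n by (cases u) auto
    then show "length (f u) = n" using \<open>length u = n\<close> by (simp add: f_def)
    show "elem_tensor (f u) w = tensor_map D a u * elem_tensor (map ?col u) w"
      by (simp add: u f_def elem_tensor_def prod.lessThan_Suc_shift del: prod.lessThan_Suc)
    have "p (c *s x) = cmod c * p x" for c x using p by (simp add: complex_seminorm_def)
    then show "(\<Prod>v\<leftarrow>f u. p v) = cmod (tensor_map D a u) * (\<Prod>m\<leftarrow>u. p (?col m))"
      by (simp add: u f_def comp_def)
  qed
  have "homogeneous_part n a w = (\<Sum>vs\<leftarrow>map f us. elem_tensor vs w)" for w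
  proof -
    have "(\<Sum>vs\<leftarrow>map f us. elem_tensor vs w) = (\<Sum>u | length u = n. elem_tensor (f u) w)"
      using us by (simp add: comp_def sum_list_distinct_conv_sum_set)
    also have "\<dots> = (\<Sum>u | length u = n. tensor_map D a u * elem_tensor (map ?col u) w)"
      by (intro sum.cong) (auto simp: f)
    also have "\<dots> = homogeneous_part n a w"
    proof (cases "length w = n")
      case True
      then show ?thesis using basis_expansion[OF inverse, of a w] by (simp add: homogeneous_part_def)
    next
      case False
      then show ?thesis by (auto simp: homogeneous_part_def elem_tensor_def intro!: sum.neutral)
    qed
    finally show ?thesis ..
  qed
  then have "homogeneous_part n a = (\<lambda>w. \<Sum>vs\<leftarrow>map f us. elem_tensor vs w)" ..
  moreover have "(\<Sum>vs\<leftarrow>map f us. \<Prod>v\<leftarrow>vs. p v) =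
      (\<Sum>u | length u = n. cmod (tensor_map D a u) * (\<Prod>m\<leftarrow>u. p (?col m)))"
  proof -
    have "(\<Sum>vs\<leftarrow>map f us. \<Prod>v\<leftarrow>vs. p v) = (\<Sum>u | length u = n. \<Prod>v\<leftarrow>f u. p v)"
      using us by (simp add: comp_def sum_list_distinct_conv_sum_set)
    also have "\<dots> = (\<Sum>u | length u = n. cmod (tensor_map D a u) * (\<Prod>m\<leftarrow>u. p (?col m)))"
      by (intro sum.cong) (auto simp: f)
    finally show ?thesis .
  qed
  moreover have "\<forall>vs\<in>set (map f us). length vs = n" using us f(1) by auto
  ultimately show ?thesis by (intro decomposition_costsI[where vss = "map f us"]) simp_all
qed

lemma decomposition_costs_nonempty:
  assumes "complex_seminorm p" "n > 0"
  shows "decomposition_costs p n (homogeneous_part n a) \<noteq> {}"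
  using basis_decomposition_cost[OF assms, of "mat 1" "mat 1" a] by auto

lemma proj_seminorm_nonneg:
  assumes "complex_seminorm p"
  shows "0 \<le> proj_seminorm p n (homogeneous_part n a)"
  using decomposition_costs_nonempty[OF assms] decomposition_costs_nonneg[OF assms]
  by (auto simp: proj_seminorm_eq intro!: cInf_greatest)

lemma proj_seminorm_zero:
  assumes "complex_seminorm p"
  shows "proj_seminorm p n (\<lambda>w. 0) = 0"
proof (cases "n = 0")
  case False
  have "0 \<in> decomposition_costs p n (\<lambda>w. 0)"
    unfolding decomposition_costs_def by (auto intro!: exI[of _ "[]"])
  then have "Inf (decomposition_costs p n (\<lambda>w. 0)) = 0"
    using decomposition_costs_nonneg[OF assms] by (intro cInf_eq_minimum)
  then show ?thesis using False by (simp add: proj_seminorm_eq)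
qed (simp add: proj_seminorm_eq)

lemma proj_seminorm_triangle:
  assumes p: "complex_seminorm p"
  shows "proj_seminorm p n (homogeneous_part n (\<lambda>w. a w + b w)) \<le>
    proj_seminorm p n (homogeneous_part n a) + proj_seminorm p n (homogeneous_part n b)"
proof (cases "n = 0")
  case True
  then show ?thesis by (simp add: proj_seminorm_eq homogeneous_part_def norm_triangle_ineq)
next
  case False
  let ?A = "decomposition_costs p n (homogeneous_part n a)"
  let ?B = "decomposition_costs p n (homogeneous_part n b)"
  let ?C = "decomposition_costs p n (homogeneous_part n (\<lambda>w. a w + b w))"
  have "Inf ?C \<le> x + y" if x: "x \<in> ?A" and y: "y \<in> ?B" for x y
  proof -
    obtain vss where vss: "x = (\<Sum>vs\<leftarrow>vss. \<Prod>v\<leftarrow>vs. p v)" "\<forall>vs\<in>set vss. length vs = n"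
        "homogeneous_part n a = (\<lambda>w. \<Sum>vs\<leftarrow>vss. elem_tensor vs w)"
      using x by (rule decomposition_costsE)
    obtain vss' where vss': "y = (\<Sum>vs\<leftarrow>vss'. \<Prod>v\<leftarrow>vs. p v)" "\<forall>vs\<in>set vss'. length vs = n"
        "homogeneous_part n b = (\<lambda>w. \<Sum>vs\<leftarrow>vss'. elem_tensor vs w)"
      using y by (rule decomposition_costsE)
    have "homogeneous_part n (\<lambda>w. a w + b w) =
        (\<lambda>w. homogeneous_part n a w + homogeneous_part n b w)"
      by (auto simp: homogeneous_part_def)
    then have "homogeneous_part n (\<lambda>w. a w + b w) = (\<lambda>w. \<Sum>vs\<leftarrow>vss @ vss'. elem_tensor vs w)"
      by (simp add: vss vss')
    moreover have "x + y = (\<Sum>vs\<leftarrow>vss @ vss'. \<Prod>v\<leftarrow>vs. p v)" by (simp add: vss vss')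
    moreover have "\<forall>vs\<in>set (vss @ vss'). length vs = n" using vss vss' by auto
    ultimately have "x + y \<in> ?C" by (intro decomposition_costsI[where vss = "vss @ vss'"])
    then show ?thesis by (intro cInf_lower bdd_below_decomposition_costs p)
  qed
  then have "Inf ?C - y \<le> Inf ?A" if "y \<in> ?B" for y
    using that decomposition_costs_nonempty[OF p] False by (intro cInf_greatest) (auto simp: diff_le_eq)
  then have "Inf ?C - Inf ?A \<le> Inf ?B"
    using decomposition_costs_nonempty[OF p] False by (intro cInf_greatest) (auto simp: diff_le_eq algebra_simps)
  then show ?thesis using False by (simp add: proj_seminorm_eq)
qed

text \<open>
  The cost of the expansion in a basis bounds the infimum, and \<open>p\<close> enters only through its values on
  the finitely many basis vectors.
\<close>

lemma proj_seminorm_upper: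
  assumes p: "complex_seminorm p" and inverse: "E ** D = mat 1" and M: "\<And>m. p (column m E) \<le> M"
  shows "proj_seminorm p n (homogeneous_part n a) \<le> (\<Sum>u | length u = n. cmod (tensor_map D a u)) * M ^ n"
proof (cases "n = 0")
  case True
  then show ?thesis by (simp add: proj_seminorm_eq homogeneous_part_def tensor_map_def)
next
  case False
  have "(\<Prod>m\<leftarrow>u. p (column m E)) \<le> M ^ length u" for u
    using complex_seminorm_nonneg[OF p] M
    by (induction u) (auto intro!: mult_mono prod_list_nonneg order_trans[OF _ M])
  then have "(\<Sum>u | length u = n. cmod (tensor_map D a u) * (\<Prod>m\<leftarrow>u. p (column m E))) \<le>
      (\<Sum>u | length u = n. cmod (tensor_map D a u) * M ^ n)"
    by (intro sum_mono mult_left_mono) auto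
  moreover have "proj_seminorm p n (homogeneous_part n a) \<le>
      (\<Sum>u | length u = n. cmod (tensor_map D a u) * (\<Prod>m\<leftarrow>u. p (column m E)))"
    using False basis_decomposition_cost[OF p _ inverse]
    by (auto simp: proj_seminorm_eq intro!: cInf_lower bdd_below_decomposition_costs p)
  ultimately show ?thesis by (simp add: sum_distrib_right)
qed

text \<open>
  Chosen to dominate the modulus of each coordinate \<open>(D *v v) $ m\<close>; unlike a maximum, the sum inherits
  the triangle inequality termwise.
\<close>

definition coord_seminorm :: "complex ^ 'm ^ 'm \<Rightarrow> complex ^ 'm \<Rightarrow> real" where
  "coord_seminorm D v = (\<Sum>m\<in>UNIV. cmod ((D *v v) $ m))"

lemma complex_seminorm_coord: "complex_seminorm (coord_seminorm D)"
  unfolding complex_seminorm_def coord_seminorm_def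
  by (auto simp: matrix_vector_right_distrib vector_scalar_commute norm_mult sum_distrib_left
      simp flip: sum.distrib intro!: sum_mono norm_triangle_ineq)

text \<open>
  A product of linear forms of norm at most 1 has norm at most 1 for the projective seminorm: it is
  bounded by the cost of each elementary tensor, hence by the cost of every decomposition.
\<close>

lemma proj_seminorm_lower:
  "cmod (tensor_map D a u) \<le> proj_seminorm (coord_seminorm D) (length u) (homogeneous_part (length u) a)"
proof (cases "u = []")
  case True
  then show ?thesis by (simp add: proj_seminorm_eq homogeneous_part_def tensor_map_def)
next
  case False
  let ?n = "length u" and ?p = "coord_seminorm D"
  have bound: "cmod (tensor_map D (elem_tensor vs) u) \<le> (\<Prod>v\<leftarrow>vs. ?p v)" if "length vs = ?n" for vs
  proof -
    have "cmod (tensor_map D (elem_tensor vs) u) = (\<Prod>k<?n. cmod ((D *v (vs ! k)) $ (u ! k)))"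
      unfolding tensor_map_elem_tensor using that by (simp add: elem_tensor_def prod_norm)
    also have "\<dots> \<le> (\<Prod>k<?n. ?p (vs ! k))"
      unfolding coord_seminorm_def by (intro prod_mono) (auto intro!: member_le_sum)
    also have "\<dots> = (\<Prod>v\<leftarrow>vs. ?p v)"
      using that by (simp add: prod.list_conv_set_nth lessThan_atLeast0)
    finally show ?thesis .
  qed
  have "cmod (tensor_map D a u) \<le> x" if x: "x \<in> decomposition_costs ?p ?n (homogeneous_part ?n a)" for x
  proof -
    obtain vss where vss: "x = (\<Sum>vs\<leftarrow>vss. \<Prod>v\<leftarrow>vs. ?p v)" "\<forall>vs\<in>set vss. length vs = ?n"
        "homogeneous_part ?n a = (\<lambda>w. \<Sum>vs\<leftarrow>vss. elem_tensor vs w)"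
      using x by (rule decomposition_costsE)
    have "tensor_map D a u = tensor_map D (homogeneous_part ?n a) u"
      by (simp add: tensor_map_homogeneous_part) (simp add: homogeneous_part_def)
    also have "cmod \<dots> \<le> x"
      unfolding vss(1,3) using vss(2)
    proof (induction vss)
      case (Cons vs vss)
      then show ?case
        using bound[of vs] norm_triangle_ineq[of "tensor_map D (elem_tensor vs) u"
            "tensor_map D (\<lambda>w. \<Sum>vs\<leftarrow>vss. elem_tensor vs w) u"]
        by (simp add: tensor_map_add)
    qed (simp add: tensor_map_def)
    finally show ?thesis .
  qed
  then show ?thesis
    using False decomposition_costs_nonempty[OF complex_seminorm_coord, of ?n]
    by (auto simp: proj_seminorm_eq intro!: cInf_greatest)
qed

section \<open>The seminorms of the Weyl algebra\<close>

lemma summable_weyl_seminorm: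
  assumes p: "complex_seminorm p" and a: "a \<in> sym_algebra"
  shows "summable (\<lambda>n. proj_seminorm p n (homogeneous_part n a) * fact n powr R)"
proof -
  obtain N where N: "\<And>w. length w \<ge> N \<Longrightarrow> a w = 0"
    using sym_algebra_degree_bound[OF a] by blast
  have "homogeneous_part n a = (\<lambda>w. 0)" if "n \<ge> N" for n
    using that N by (auto simp: homogeneous_part_def)
  then show ?thesis
    by (intro summable_finite[of "{..<N}"]) (auto simp: proj_seminorm_zero[OF p])
qed

lemma weyl_seminorm_zero: "complex_seminorm p \<Longrightarrow> weyl_seminorm p R (\<lambda>w. 0) = 0"
  by (simp add: weyl_seminorm_def homogeneous_part_def proj_seminorm_zero)

lemma weyl_seminorm_triangle:
  assumes p: "complex_seminorm p" and a: "a \<in> sym_algebra" and b: "b \<in> sym_algebra"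
  shows "weyl_seminorm p R (\<lambda>w. a w + b w) \<le> weyl_seminorm p R a + weyl_seminorm p R b"
proof -
  note [simp] = summable_weyl_seminorm[OF p a] summable_weyl_seminorm[OF p b]
  have "proj_seminorm p n (homogeneous_part n (\<lambda>w. a w + b w)) * fact n powr R \<le>
      proj_seminorm p n (homogeneous_part n a) * fact n powr R +
      proj_seminorm p n (homogeneous_part n b) * fact n powr R" for n
    unfolding distrib_right[symmetric] by (intro mult_right_mono proj_seminorm_triangle p) simp
  then show ?thesis
    unfolding weyl_seminorm_def
    by (subst suminf_add)
       (auto intro!: suminf_le summable_add summable_weyl_seminorm[OF p sym_algebra_add[OF a b]])
qed

section \<open>Comparison of the seminorms\<close>

text \<open>
  A single coordinate is bounded by the projective seminorm of its degree, which is one term of the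
  series, and the factor \<open>n! = n!\<^bsup>1-\<epsilon>\<^esup> n!\<^sup>\<epsilon>\<close> matches the two weights.
\<close>

lemma coeff_norm_le_weyl_seminorm:
  assumes a: "a \<in> sym_algebra"
  shows "coeff_norm \<epsilon> a \<le> weyl_seminorm (coord_seminorm z_dual) (1 - \<epsilon>) a"
proof (rule coeff_norm_least[OF a])
  fix u
  let ?p = "coord_seminorm z_dual" and ?n = "length u" and ?c = "cmod (tensor_map z_dual a u)"
  have "fact ?n * ?c = ?c * fact ?n powr (1 - \<epsilon>) * fact ?n powr \<epsilon>"
    by (simp add: mult.assoc flip: powr_add)
  also have "?c * fact ?n powr (1 - \<epsilon>) \<le> weyl_seminorm ?p (1 - \<epsilon>) a"
  proof -
    let ?f = "\<lambda>n. proj_seminorm ?p n (homogeneous_part n a) * fact n powr (1 - \<epsilon>)"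
    have "?c * fact ?n powr (1 - \<epsilon>) \<le> ?f ?n"
      by (intro mult_right_mono proj_seminorm_lower) simp
    also have "\<dots> = sum ?f {?n}" by simp
    also have "\<dots> \<le> suminf ?f"
      by (rule sum_le_suminf[OF summable_weyl_seminorm[OF complex_seminorm_coord a]])
         (auto simp: proj_seminorm_nonneg[OF complex_seminorm_coord])
    finally show ?thesis by (simp add: weyl_seminorm_def)
  qed
  finally show "fact ?n * ?c \<le> weyl_seminorm ?p (1 - \<epsilon>) a * fact ?n powr \<epsilon>"
    by (simp add: mult_right_mono)
qed

text \<open>
  Every positive power of the factorial grows faster than any exponential. This is why the
  loss in \<open>\<epsilon>\<close> below pays both for the number of words and for the size of \<open>p\<close> on the basis.
\<close>

lemma summable_power_fact_powr:
  fixes K \<delta> :: real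
  assumes K: "K > 0" and \<delta>: "\<delta> > 0"
  shows "summable (\<lambda>n. K ^ n * fact n powr - \<delta>)"
proof -
  have "filterlim (\<lambda>n. real (Suc n)) at_top sequentially"
    using filterlim_compose[OF filterlim_real_sequentially filterlim_Suc] .
  then have "((\<lambda>n. K * real (Suc n) powr - \<delta>) \<longlongrightarrow> K * 0) sequentially"
    by (intro tendsto_mult_left tendsto_neg_powr) (use \<delta> in auto)
  then have "\<forall>\<^sub>F n in sequentially. K * real (Suc n) powr - \<delta> < 1/2"
    by (intro order_tendstoD) auto
  then obtain N where N: "\<And>n. n \<ge> N \<Longrightarrow> K * real (Suc n) powr - \<delta> < 1/2"
    unfolding eventually_sequentially by blast
  show ?thesis
  proof (rule summable_ratio_test[of "1/2" N])
    fix n assume "n \<ge> N"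
    have "K ^ Suc n * fact (Suc n) powr - \<delta> = (K * real (Suc n) powr - \<delta>) * (K ^ n * fact n powr - \<delta>)"
      by (simp add: powr_mult del: of_nat_Suc)
    also have "\<dots> \<le> 1/2 * (K ^ n * fact n powr - \<delta>)"
      using N[OF \<open>n \<ge> N\<close>] K by (intro mult_right_mono) auto
    finally show "norm (K ^ Suc n * fact (Suc n) powr - \<delta>) \<le> 1/2 * norm (K ^ n * fact n powr - \<delta>)"
      using K by (simp add: abs_mult)
  qed simp
qed

text \<open>
  There are \<open>(2d)\<^sup>n\<close> words of length \<open>n\<close>, each with a coordinate of size at most
  \<open>n!\<^bsup>\<epsilon>/2 - 1\<^esup>\<close> times the norm. Hence the term of degree \<open>n\<close> of the series is at most
  \<open>(2d M)\<^sup>n n!\<^bsup>\<epsilon>/2 - 1\<^esup> n!\<^bsup>1-\<epsilon>\<^esup> = (2d M)\<^sup>n n!\<^bsup>-\<epsilon>/2\<^esup>\<close> times the norm, which is summable. Here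
  \<open>M\<close> bounds \<open>p\<close> on the basis vectors.
\<close>

lemma weyl_seminorm_le_coeff_norm:
  fixes p :: "complex ^ ('d::{finite,linorder} + 'd) \<Rightarrow> real"
  assumes p: "complex_seminorm p" and \<epsilon>: "\<epsilon> > 0"
  obtains C where "C > 0"
    "\<And>a. a \<in> sym_algebra \<Longrightarrow> weyl_seminorm p (1 - \<epsilon>) a \<le> C * coeff_norm (\<epsilon> / 2) a"
proof -
  \<comment> \<open>the summand 1 makes \<open>M\<close> positive also when \<open>p\<close> vanishes\<close>
  define M where "M = 1 + (\<Sum>m\<in>UNIV. p (column m z_basis))"
  define K where "K = real (CARD('d + 'd)) * M"
  define f where "f n = K ^ n * fact n powr - (\<epsilon> / 2)" for n
  have "p (column m z_basis) \<le> M" for m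
    using member_le_sum[of m UNIV "\<lambda>m. p (column m z_basis)"] complex_seminorm_nonneg[OF p]
    by (simp add: M_def)
  note upper = proj_seminorm_upper[OF p z_basis_z_dual this]
  have "M > 0" by (simp add: M_def add_pos_nonneg sum_nonneg complex_seminorm_nonneg[OF p])
  then have "K > 0" by (simp add: K_def)
  then have sum_f: "summable f" and f_pos: "f n > 0" for n
    using summable_power_fact_powr \<epsilon> by (simp_all add: f_def[abs_def])
  have "weyl_seminorm p (1 - \<epsilon>) a \<le> suminf f * coeff_norm (\<epsilon> / 2) a" if a: "a \<in> sym_algebra" for a
  proof -
    let ?N = "coeff_norm (\<epsilon> / 2) a"
    have "proj_seminorm p n (homogeneous_part n a) * fact n powr (1 - \<epsilon>) \<le> f n * ?N" for n
    proof -
      have "cmod (tensor_map z_dual a u) \<le> ?N * fact n powr (\<epsilon> / 2 - 1)" if "length u = n" for u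
        using coeff_norm_upper[OF a, of u "\<epsilon> / 2"] that
        by (simp add: powr_diff pos_le_divide_eq mult.commute)
      then have "(\<Sum>u | length u = n. cmod (tensor_map z_dual a u)) \<le>
          (\<Sum>u :: ('d + 'd) list | length u = n. ?N * fact n powr (\<epsilon> / 2 - 1))"
        by (intro sum_mono) auto
      then have "(\<Sum>u | length u = n. cmod (tensor_map z_dual a u)) * M ^ n \<le>
          (real (CARD('d + 'd)) ^ n * (?N * fact n powr (\<epsilon> / 2 - 1))) * M ^ n"
        using \<open>M > 0\<close> by (intro mult_right_mono) (simp_all add: card_words)
      then have "proj_seminorm p n (homogeneous_part n a) * fact n powr (1 - \<epsilon>) \<le>
          (real (CARD('d + 'd)) ^ n * (?N * fact n powr (\<epsilon> / 2 - 1))) * M ^ n * fact n powr (1 - \<epsilon>)"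
        using upper[of n a] by (intro mult_right_mono) auto
      also have "\<dots> = K ^ n * ?N * (fact n powr (\<epsilon> / 2 - 1) * fact n powr (1 - \<epsilon>))"
        by (simp only: K_def power_mult_distrib mult_ac)
      also have "fact n powr (\<epsilon> / 2 - 1) * fact n powr (1 - \<epsilon>) = (fact n :: real) powr - (\<epsilon> / 2)"
        by (simp flip: powr_add)
      finally show ?thesis by (simp add: f_def mult_ac)
    qed
    then have "weyl_seminorm p (1 - \<epsilon>) a \<le> (\<Sum>n. f n * ?N)"
      unfolding weyl_seminorm_def
      by (intro suminf_le summable_weyl_seminorm p a summable_mult2 sum_f)
    then show ?thesis by (simp add: suminf_mult2[OF sum_f])
  qed
  moreover have "suminf f > 0" using suminf_pos[OF sum_f f_pos] .
  ultimately show ?thesis using that by blast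
qed

theorem proposition5p17:
  shows "seminorm_topology (sym_algebra :: ('d::{finite,linorder} + 'd) tensor set)
           {coeff_norm \<epsilon> | \<epsilon>. 0 < \<epsilon>}
         = weyl_topology 1"
proof -
  let ?S = "sym_algebra :: ('d + 'd) tensor set"
  let ?Q = "{coeff_norm \<epsilon> | \<epsilon>. 0 < \<epsilon>} :: (('d + 'd) tensor \<Rightarrow> real) set"
  let ?W = "{weyl_seminorm p (1 - \<epsilon>) | p \<epsilon>. complex_seminorm p \<and> 0 < \<epsilon>} :: (('d + 'd) tensor \<Rightarrow> real) set"
  have "openin (seminorm_topology ?S ?W) U" if "openin (seminorm_topology ?S ?Q) U" for U
  proof (rule seminorm_topology_coarser[OF sym_algebra_diff _ _ _ that])
    fix q assume "q \<in> ?Q"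
    then obtain \<epsilon> where q: "q = coeff_norm \<epsilon>" "\<epsilon> > 0" by blast
    have "weyl_seminorm (coord_seminorm z_dual) (1 - \<epsilon>) \<in> ?W"
      using q(2) complex_seminorm_coord by blast
    moreover have "\<forall>a\<in>?S. q a \<le> 1 * weyl_seminorm (coord_seminorm z_dual) (1 - \<epsilon>) a"
      by (simp add: q(1) coeff_norm_le_weyl_seminorm)
    ultimately show "\<exists>q'\<in>?W. \<exists>C>0. \<forall>a\<in>?S. q a \<le> C * q' a"
      using zero_less_one by blast
  qed (auto simp: coeff_norm_triangle weyl_seminorm_zero)
  moreover have "openin (seminorm_topology ?S ?Q) U" if "openin (seminorm_topology ?S ?W) U" for U
  proof (rule seminorm_topology_coarser[OF sym_algebra_diff _ _ _ that])
    fix q assume "q \<in> ?W"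
    then obtain p \<epsilon> where q: "q = weyl_seminorm p (1 - \<epsilon>)" "complex_seminorm p" "\<epsilon> > 0" by blast
    obtain C where "C > 0" "\<And>a. a \<in> ?S \<Longrightarrow> q a \<le> C * coeff_norm (\<epsilon> / 2) a"
      using weyl_seminorm_le_coeff_norm[OF q(2,3)] unfolding q(1) by blast
    moreover have "coeff_norm (\<epsilon> / 2) \<in> ?Q" using q(3) half_gt_zero by blast
    ultimately show "\<exists>q'\<in>?Q. \<exists>C>0. \<forall>a\<in>?S. q a \<le> C * q' a" by blast
  qed (auto simp: weyl_seminorm_triangle coeff_norm_zero)
  ultimately show ?thesis unfolding weyl_topology_def topology_eq by blast
qed

end
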